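(* Consider the three-firm (triopoly) sequential quantity game described in the context, with associated stationary responses $b_2,b_3$ and hierarchical map $\mathcal G_1$, satisfying the following conditions: 1. Each firm $i$ produces quantities in a closed, nonempty subset $X_i$ of $(\mathbb R,|\cdot|)$. 2. There exists a nonempty closed set $D\subseteq X_1\times X_2\times X_3$ such that $\mathcal G_1(D)\subseteq D$. 3. There exists $\alpha\in(0,1)$ such that, for all $\overline{x},\overline{u}\in D$, $M_1(\mathcal G_1(\overline{x}),\mathcal G_1(\overline{u}))\le\alpha M_1(\overline{x},\overline{u})$. Then: 1. There exists a unique stationary Stackelberg triple $(\xi,\eta,\theta)\in D$; equivalently, there is a unique $(\xi,\eta,\theta)\in D$ with $\mathcal G_1(\xi,\eta,\theta)=(\xi,\eta,\theta)$. 2. For every initial point $(x_0,y_0,z_0)\in D$, the fixed-point iteration $(x_{n+1},y_{n+1},z_{n+1})=\mathcal G_1(x_n,y_n,z_n)$, $n=0,1,2,\ldots$, converges to $(\xi,\eta,\theta)$. 3. If, in addition, $X_1=X_2=X_3=X$ and $\mathcal G_1$ satisfies the local triple cross-symmetry property at $(\xi,\eta,\theta)$, then $\xi=\eta=\theta$.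
   Context: Market. Three firms choose outputs $x\in X_1$, $y\in X_2$, $z\in X_3$, $X_i\subseteq\mathbb R$. With inverse demand function $P$ and cost functions $c_1,c_2,c_3$ (real-valued functions of a real variable), the payoffs are $\Pi_1(x,y,z)=xP(x+y+z)-c_1(x)$, $\Pi_2(x,y,z)=yP(x+y+z)-c_2(y)$, $\Pi_3(x,y,z)=zP(x+y+z)-c_3(z)$. All derivatives appearing below are assumed to exist; each is taken with respect to a variable ranging over the corresponding set $X_i$. Derivative-generated maps and stationary responses (defined recursively), together with the standing assumptions. - $F_3(x,y,z)=z+\frac{\partial\Pi_3}{\partial z}(x,y,z)$; it is assumed that for every $(x,y)\in X_1\times X_2$ the equation $F_3(x,y,z)=z$ has a unique solution $z=b_3(x,y)\in X_3$. - $\Phi_2(x,y)=\Pi_2(x,y,b_3(x,y))$ and $F_2(x,y,z)=y+\frac{\partial\Phi_2}{\partial y}(x,y)$; it is assumed that for every $x\in X_1$ the equation $F_2(x,y,b_3(x,y))=y$ has a unique solution $y=b_2(x)\in X_2$. - $\Phi_1(x)=\Pi_1(x,b_2(x),b_3(x,b_2(x)))$ and $F_1(x,y,z)=x+\frac{d\Phi_1}{dx}(x)$, assumed to take values in $X_1$. Hierarchical map. $\mathcal G_1:X_1\times X_2\times X_3\to X_1\times X_2\times X_3$, $\mathcal G_1(x,y,z)=\bigl(F_1(x,b_2(x),b_3(x,b_2(x))),\,b_2(x),\,b_3(x,b_2(x))\bigr)$. Stationary Stackelberg triple. $(x^*,y^*,z^* )\in X_1\times X_2\times X_3$ such that $\frac{d\Phi_1}{dx}(x^*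 )=0$, $\frac{\partial\Phi_2}{\partial y}(x^*,y^* )=0$, $\frac{\partial\Pi_3}{\partial z}(x^*,y^*,z^* )=0$, and $y^*=b_2(x^* )$, $z^*=b_3(x^*,y^* )=b_3(x^*,b_2(x^* ))$. Metric. $M_1((x,y,z),(u,v,w))=|x-u|+|y-v|+|z-w|$. Local triple cross-symmetry. When $X_1=X_2=X_3=X$, a map $S=(S^1,S^2,S^3):X^3\to X^3$ satisfies the local triple cross-symmetry property at $(x^*,y^*,z^* )\in X^3$ if $S^1(y^*,z^*,x^* )=S^2(x^*,y^*,z^* )$, $S^2(y^*,z^*,x^* )=S^3(x^*,y^*,z^* )$, and $S^3(y^*,z^*,x^* )=S^1(x^*,y^*,z^* )$.
   Formalization: Item 3 additionally assumes that the cyclically shifted point (η,θ,ξ) lies in D; without this it fails, e.g. for a game with G₁(x,y,z)=(x,0,1−x) and D={(1,0,0)}, where cross-symmetry holds at (1,0,0). *)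

theory Defs
  imports "HOL-Analysis.Analysis"
begin

record triopoly =
  demand :: "real \<Rightarrow> real"
  cost1 :: "real \<Rightarrow> real"
  cost2 :: "real \<Rightarrow> real"
  cost3 :: "real \<Rightarrow> real"
  X1 :: "real set"
  X2 :: "real set"
  X3 :: "real set"

definition \<Pi>1 :: "triopoly \<Rightarrow> real \<Rightarrow> real \<Rightarrow> real \<Rightarrow> real" where
  "\<Pi>1 T x y z = x * demand T (x + y + z) - cost1 T x"

definition \<Pi>2 :: "triopoly \<Rightarrow> real \<Rightarrow> real \<Rightarrow> real \<Rightarrow> real" where
  "\<Pi>2 T x y z = y * demand T (x + y + z) - cost2 T y"

definition \<Pi>3 :: "triopoly \<Rightarrow> real \<Rightarrow> real \<Rightarrow> real \<Rightarrow> real" where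
  "\<Pi>3 T x y z = z * demand T (x + y + z) - cost3 T z"

text \<open>
  Derivatives are taken within the strategy sets. For a real function of a real variable,
  \<^const>\<open>vector_derivative\<close> is the ordinary derivative, relative to the set in the filter.
  At an isolated point of that set every number is a derivative in the sense of the library,
  so there the chosen value is unspecified.
\<close>

definition d\<Pi>3 :: "triopoly \<Rightarrow> real \<Rightarrow> real \<Rightarrow> real \<Rightarrow> real" where
  "d\<Pi>3 T x y z = vector_derivative (\<lambda>t. \<Pi>3 T x y t) (at z within X3 T)"

definition F3 :: "triopoly \<Rightarrow> real \<Rightarrow> real \<Rightarrow> real \<Rightarrow> real" where
  "F3 T x y z = z + d\<Pi>3 T x y z"

definition b3 :: "triopoly \<Rightarrow> real \<Rightarrow> real \<Rightarrow> real" where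
  "b3 T x y = (THE z. z \<in> X3 T \<and> F3 T x y z = z)"

definition \<Phi>2 :: "triopoly \<Rightarrow> real \<Rightarrow> real \<Rightarrow> real" where
  "\<Phi>2 T x y = \<Pi>2 T x y (b3 T x y)"

definition d\<Phi>2 :: "triopoly \<Rightarrow> real \<Rightarrow> real \<Rightarrow> real" where
  "d\<Phi>2 T x y = vector_derivative (\<lambda>t. \<Phi>2 T x t) (at y within X2 T)"

definition F2 :: "triopoly \<Rightarrow> real \<Rightarrow> real \<Rightarrow> real \<Rightarrow> real" where
  "F2 T x y z = y + d\<Phi>2 T x y"

definition b2 :: "triopoly \<Rightarrow> real \<Rightarrow> real" where
  "b2 T x = (THE y. y \<in> X2 T \<and> F2 T x y (b3 T x y) = y)"

definition \<Phi>1 :: "triopoly \<Rightarrow> real \<Rightarrow> real" where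
  "\<Phi>1 T x = \<Pi>1 T x (b2 T x) (b3 T x (b2 T x))"

definition d\<Phi>1 :: "triopoly \<Rightarrow> real \<Rightarrow> real" where
  "d\<Phi>1 T x = vector_derivative (\<Phi>1 T) (at x within X1 T)"

definition F1 :: "triopoly \<Rightarrow> real \<Rightarrow> real \<Rightarrow> real \<Rightarrow> real" where
  "F1 T x y z = x + d\<Phi>1 T x"

definition derivatives_exist :: "triopoly \<Rightarrow> bool" where
  "derivatives_exist T \<longleftrightarrow>
     (\<forall>x\<in>X1 T. \<forall>y\<in>X2 T. \<forall>z\<in>X3 T. (\<lambda>t. \<Pi>3 T x y t) differentiable (at z within X3 T)) \<and>
     (\<forall>x\<in>X1 T. \<forall>y\<in>X2 T. (\<lambda>t. \<Phi>2 T x t) differentiable (at y within X2 T)) \<and>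
     (\<forall>x\<in>X1 T. \<Phi>1 T differentiable (at x within X1 T))"

definition standing_assumptions :: "triopoly \<Rightarrow> bool" where
  "standing_assumptions T \<longleftrightarrow>
     derivatives_exist T \<and>
     (\<forall>x\<in>X1 T. \<forall>y\<in>X2 T. \<exists>!z. z \<in> X3 T \<and> F3 T x y z = z) \<and>
     (\<forall>x\<in>X1 T. \<exists>!y. y \<in> X2 T \<and> F2 T x y (b3 T x y) = y) \<and>
     (\<forall>x\<in>X1 T. \<forall>y\<in>X2 T. \<forall>z\<in>X3 T. F1 T x y z \<in> X1 T)"

definition \<G>1 :: "triopoly \<Rightarrow> real \<times> real \<times> real \<Rightarrow> real \<times> real \<times> real" where
  "\<G>1 T = (\<lambda>(x, y, z).
     (F1 T x (b2 T x) (b3 T x (b2 T x)), b2 T x, b3 T x (b2 T x)))"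

definition stationary_stackelberg :: "triopoly \<Rightarrow> real \<times> real \<times> real \<Rightarrow> bool" where
  "stationary_stackelberg T = (\<lambda>(x, y, z).
     x \<in> X1 T \<and> y \<in> X2 T \<and> z \<in> X3 T \<and>
     d\<Phi>1 T x = 0 \<and> d\<Phi>2 T x y = 0 \<and> d\<Pi>3 T x y z = 0 \<and>
     y = b2 T x \<and> z = b3 T x y)"

definition M1 :: "real \<times> real \<times> real \<Rightarrow> real \<times> real \<times> real \<Rightarrow> real" where
  "M1 = (\<lambda>(x, y, z) (u, v, w). \<bar>x - u\<bar> + \<bar>y - v\<bar> + \<bar>z - w\<bar>)"

text \<open>
  The property at \<open>(x, y, z)\<close> also evaluates \<open>S\<close> at \<open>(y, z, x)\<close>. It does not imply that
  \<open>(y, z, x)\<close> lies in a given \<open>S\<close>-invariant set containing \<open>(x, y, z)\<close>; where the property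
  is meant for the restriction of \<open>S\<close> to such a set, that membership is a separate hypothesis.
\<close>

definition local_triple_cross_symmetry ::
    "('a \<times> 'a \<times> 'a \<Rightarrow> 'a \<times> 'a \<times> 'a) \<Rightarrow> 'a \<times> 'a \<times> 'a \<Rightarrow> bool" where
  "local_triple_cross_symmetry S = (\<lambda>(x, y, z).
     fst (S (y, z, x)) = fst (snd (S (x, y, z))) \<and>
     fst (snd (S (y, z, x))) = snd (snd (S (x, y, z))) \<and>
     snd (snd (S (y, z, x))) = fst (S (x, y, z)))"

end

theory Submission
  imports Defs
begin

text \<open>
  A point \<open>(x, y, z)\<close> is fixed by the hierarchical map exactly when \<open>y\<close> and \<open>z\<close> are the
  followers' responses and \<open>x\<close> is a critical point of the leader's reduced payoff. Responses are
  by construction zeros of the followers' marginal payoffs, so fixed points and stationary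
  Stackelberg triples are the same thing (\<open>stationary_iff_fixed\<close>).

  The rest is Banach's fixed point theorem on \<open>D\<close>. The contraction is measured in the taxicab
  metric \<open>M1\<close> and not in the Euclidean distance of the product type, but the two differ by at most
  a factor of \<open>3\<close>. The factor may destroy the contraction property of the map itself, yet not of a
  high enough iterate; and an iterate's only fixed point is also fixed by the map
  (\<open>contraction_equivalent_metric_fixpoint\<close>).

  Cross-symmetry at a fixed triple says that its cyclic shift \<open>(\<eta>, \<theta>, \<xi>)\<close> is fixed as well. As the
  shift lies in \<open>D\<close>, uniqueness identifies it with \<open>(\<xi>, \<eta>, \<theta>)\<close>.
\<close>

lemma dist_le_M1: "dist p q \<le> M1 p q"
proof -
  obtain x y z u v w where pq: "p = (x, y, z)" "q = (u, v, w)"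
    by (cases p, cases q) auto
  have "dist p q \<le> dist x u + dist (y, z) (v, w)"
    unfolding pq dist_Pair_Pair by (rule sqrt_sum_squares_le_sum) auto
  also have "dist (y, z) (v, w) \<le> dist y v + dist z w"
    unfolding dist_Pair_Pair by (rule sqrt_sum_squares_le_sum) auto
  finally show ?thesis
    by (simp add: pq M1_def dist_real_def)
qed

lemma M1_le_3_dist: "M1 p q \<le> 3 * dist p q"
proof -
  obtain x y z u v w where pq: "p = (x, y, z)" "q = (u, v, w)"
    by (cases p, cases q) auto
  have "dist x u \<le> dist p q" "dist (y, z) (v, w) \<le> dist p q"
    using dist_fst_le[of p q] dist_snd_le[of p q] by (simp_all add: pq)
  moreover have "dist y v \<le> dist (y, z) (v, w)" "dist z w \<le> dist (y, z) (v, w)"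
    using dist_fst_le[of "(y, z)" "(v, w)"] dist_snd_le[of "(y, z)" "(v, w)"] by simp_all
  ultimately show ?thesis
    by (simp add: pq M1_def dist_real_def)
qed

lemma funpow_in_invariant_set:
  assumes "f ` S \<subseteq> S" "p \<in> S"
  shows "(f ^^ n) p \<in> S"
  using assms by (induction n) auto

lemma funpow_contraction_bound:
  fixes M :: "'a \<Rightarrow> 'a \<Rightarrow> real"
  assumes "f ` S \<subseteq> S" "0 \<le> \<alpha>"
    and contr: "\<And>p q. p \<in> S \<Longrightarrow> q \<in> S \<Longrightarrow> M (f p) (f q) \<le> \<alpha> * M p q"
    and "p \<in> S" "q \<in> S"
  shows "M ((f ^^ n) p) ((f ^^ n) q) \<le> \<alpha> ^ n * M p q"
proof (induction n)
  case (Suc n)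
  have "M ((f ^^ Suc n) p) ((f ^^ Suc n) q) \<le> \<alpha> * M ((f ^^ n) p) ((f ^^ n) q)"
    using assms funpow_in_invariant_set[of f S] by (auto intro: contr)
  also have "\<dots> \<le> \<alpha> * (\<alpha> ^ n * M p q)"
    using Suc \<open>0 \<le> \<alpha>\<close> by (rule mult_left_mono)
  finally show ?case by (simp add: mult.assoc)
qed simp

text \<open>
  Since \<open>K * \<alpha> ^ k\<close> tends to \<open>0\<close>, some iterate \<open>f ^^ k\<close> contracts the ambient distance, and so it
  has a unique fixed point \<open>p\<close>. Since \<open>f\<close> commutes with the iterate, \<open>f p\<close> is another fixed point
  of the iterate unless \<open>f p = p\<close>.
\<close>

lemma contraction_equivalent_metric_fixpoint:
  fixes f :: "'a::metric_space \<Rightarrow> 'a" and M :: "'a \<Rightarrow> 'a \<Rightarrow> real"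
  assumes S: "complete S" "S \<noteq> {}" "f ` S \<subseteq> S"
    and \<alpha>: "0 \<le> \<alpha>" "\<alpha> < 1"
    and contr: "\<And>p q. p \<in> S \<Longrightarrow> q \<in> S \<Longrightarrow> M (f p) (f q) \<le> \<alpha> * M p q"
    and lower: "\<And>p q. dist p q \<le> M p q"
    and upper: "\<And>p q. M p q \<le> K * dist p q"
  shows "\<exists>!p. p \<in> S \<and> f p = p"
proof -
  have "(\<lambda>k. \<alpha> ^ k * K) \<longlonglongrightarrow> 0"
    using \<alpha> by (intro tendsto_mult_left_zero LIMSEQ_realpow_zero)
  then have "\<forall>\<^sub>F k in sequentially. \<alpha> ^ k * K < 1"
    by (rule order_tendstoD) simp
  then obtain k where k: "\<alpha> ^ k * K < 1"
    by (auto simp: eventually_sequentially)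
  let ?g = "f ^^ k"
  \<comment> \<open>The maximum covers a negative \<open>K\<close>, which is possible when all distances vanish.\<close>
  let ?c = "max 0 (\<alpha> ^ k * K)"
  have contr_g: "dist (?g p) (?g q) \<le> ?c * dist p q" if "p \<in> S" "q \<in> S" for p q
  proof -
    have "dist (?g p) (?g q) \<le> M (?g p) (?g q)"
      by (rule lower)
    also have "\<dots> \<le> \<alpha> ^ k * M p q"
      using S(3) \<alpha>(1) contr that by (rule funpow_contraction_bound)
    also have "\<dots> \<le> \<alpha> ^ k * (K * dist p q)"
      using upper \<alpha>(1) by (intro mult_left_mono) auto
    also have "\<dots> \<le> ?c * dist p q"
      unfolding mult.assoc[symmetric] by (intro mult_right_mono) auto
    finally show ?thesis .
  qed
  have "\<exists>!p. p \<in> S \<and> ?g p = p"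
    by (rule Banach_fix[of S ?c ?g])
      (use S k contr_g funpow_in_invariant_set[OF S(3)] in auto)
  then obtain p where p: "p \<in> S" "?g p = p"
    and unique_g: "\<And>q. q \<in> S \<Longrightarrow> ?g q = q \<Longrightarrow> q = p"
    by blast
  have "?g (f p) = f p"
    using funpow_swap1[of f k p, symmetric] unfolding p(2) .
  then have "f p = p"
    using unique_g p(1) S(3) by blast
  moreover have "q = p" if "q \<in> S" "f q = q" for q
  proof -
    have "?g q = q"
      using that(2) by (induction k) auto
    then show ?thesis
      using unique_g that(1) by blast
  qed
  ultimately show ?thesis
    using p(1) by blast
qed

lemma contraction_iterates_tendsto_fixpoint:
  fixes f :: "'a::metric_space \<Rightarrow> 'a" and M :: "'a \<Rightarrow> 'a \<Rightarrow> real"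
  assumes "f ` S \<subseteq> S" "0 \<le> \<alpha>" "\<alpha> < 1"
    and contr: "\<And>p q. p \<in> S \<Longrightarrow> q \<in> S \<Longrightarrow> M (f p) (f q) \<le> \<alpha> * M p q"
    and lower: "\<And>p q. dist p q \<le> M p q"
    and "p \<in> S" "f p = p" "q \<in> S"
  shows "(\<lambda>n. (f ^^ n) q) \<longlonglongrightarrow> p"
proof -
  have fix_iterate: "(f ^^ n) p = p" for n
    using \<open>f p = p\<close> by (induction n) auto
  have bound: "dist ((f ^^ n) q) p \<le> \<alpha> ^ n * M q p" for n
    using order_trans[OF lower funpow_contraction_bound[of f S \<alpha> M q p n]] assms
    by (simp add: fix_iterate)
  have "(\<lambda>n. \<alpha> ^ n * M q p) \<longlonglongrightarrow> 0"
    using assms by (intro tendsto_mult_left_zero LIMSEQ_realpow_zero)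
  then have "(\<lambda>n. dist ((f ^^ n) q) p) \<longlonglongrightarrow> 0"
    by (rule Lim_null_comparison[rotated]) (simp add: bound)
  then show ?thesis
    by (rule tendsto_dist_iff[THEN iffD2])
qed

text \<open>
  The standing assumptions make the descriptions of \<open>b3\<close> and \<open>b2\<close> proper, so that the responses
  solve the fixed point equations of \<open>F3\<close> and \<open>F2\<close>; cancelling the identity part leaves the
  first-order conditions.
\<close>

lemma b3_first_order:
  assumes "standing_assumptions T" "x \<in> X1 T" "y \<in> X2 T"
  shows "b3 T x y \<in> X3 T \<and> d\<Pi>3 T x y (b3 T x y) = 0"
proof -
  have "\<exists>!z. z \<in> X3 T \<and> F3 T x y z = z"
    using assms by (simp add: standing_assumptions_def)
  from theI'[OF this] show ?thesis
    by (simp add: b3_def F3_def)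
qed

lemma b2_first_order:
  assumes "standing_assumptions T" "x \<in> X1 T"
  shows "b2 T x \<in> X2 T \<and> d\<Phi>2 T x (b2 T x) = 0"
proof -
  have "\<exists>!y. y \<in> X2 T \<and> F2 T x y (b3 T x y) = y"
    using assms by (simp add: standing_assumptions_def)
  from theI'[OF this] show ?thesis
    by (simp add: b2_def F2_def)
qed

text \<open>
  Being fixed only demands \<open>d\<Phi>1 T x = 0\<close> of the leader, \<open>y = b2 T x\<close> and \<open>z = b3 T x (b2 T x)\<close>;
  the other two conditions of stationarity come for free with the responses.
\<close>

lemma stationary_iff_fixed:
  assumes "standing_assumptions T" "p \<in> X1 T \<times> X2 T \<times> X3 T"
  shows "stationary_stackelberg T p \<longleftrightarrow> \<G>1 T p = p"
proof -
  obtain x y z where p: "p = (x, y, z)" and x: "x \<in> X1 T"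
    using assms(2) by auto
  note r2 = b2_first_order[OF assms(1) x]
  note r3 = b3_first_order[OF assms(1) x conjunct1[OF r2]]
  show ?thesis
    using r2 r3 x by (auto simp: p stationary_stackelberg_def \<G>1_def F1_def)
qed

lemma cross_symmetry_shift_fixed:
  assumes "local_triple_cross_symmetry S (x, y, z)" "S (x, y, z) = (x, y, z)"
  shows "S (y, z, x) = (y, z, x)"
  using assms by (simp add: local_triple_cross_symmetry_def prod_eq_iff)

theorem corollary3:
  fixes T :: triopoly and D :: "(real \<times> real \<times> real) set" and \<alpha> :: real
  assumes standing: "standing_assumptions T"
    and closed_sets: "closed (X1 T)" "closed (X2 T)" "closed (X3 T)"
    and nonempty_sets: "X1 T \<noteq> {}" "X2 T \<noteq> {}" "X3 T \<noteq> {}"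
    and D_sub: "D \<subseteq> X1 T \<times> X2 T \<times> X3 T"
    and D_closed: "closed D" and D_nonempty: "D \<noteq> {}"
    and D_invariant: "\<G>1 T ` D \<subseteq> D"
    and \<alpha>: "0 < \<alpha>" "\<alpha> < 1"
    and contraction: "\<forall>p\<in>D. \<forall>q\<in>D. M1 (\<G>1 T p) (\<G>1 T q) \<le> \<alpha> * M1 p q"
  shows "(\<exists>!p. p \<in> D \<and> stationary_stackelberg T p) \<and>
    (\<exists>!p. p \<in> D \<and> \<G>1 T p = p) \<and>
    (\<forall>p\<in>D. stationary_stackelberg T p \<longleftrightarrow> \<G>1 T p = p) \<and>
    (\<forall>\<xi> \<eta> \<theta>. (\<xi>, \<eta>, \<theta>) \<in> D \<and> stationary_stackelberg T (\<xi>, \<eta>, \<theta>) \<longrightarrow>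
       (\<forall>p\<^sub>0\<in>D. (\<lambda>n. (\<G>1 T ^^ n) p\<^sub>0) \<longlonglongrightarrow> (\<xi>, \<eta>, \<theta>)) \<and>
       (X1 T = X2 T \<and> X2 T = X3 T \<and> (\<eta>, \<theta>, \<xi>) \<in> D \<and>
          local_triple_cross_symmetry (\<G>1 T) (\<xi>, \<eta>, \<theta>) \<longrightarrow>
        \<xi> = \<eta> \<and> \<eta> = \<theta>))"
proof -
  have contr: "M1 (\<G>1 T p) (\<G>1 T q) \<le> \<alpha> * M1 p q" if "p \<in> D" "q \<in> D" for p q
    using contraction that by blast
  have \<alpha>_nonneg: "0 \<le> \<alpha>"
    using \<alpha>(1) by simp
  have unique_fixed: "\<exists>!p. p \<in> D \<and> \<G>1 T p = p"
    by (rule contraction_equivalent_metric_fixpoint[where M = M1 and K = 3])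
      (fact complete_eq_closed[THEN iffD2, OF D_closed] D_nonempty D_invariant \<alpha>_nonneg \<alpha>(2)
        contr dist_le_M1 M1_le_3_dist)+
  have stationary: "stationary_stackelberg T p \<longleftrightarrow> \<G>1 T p = p" if "p \<in> D" for p
    using stationary_iff_fixed[OF standing] D_sub that by blast
  have unique_stationary: "\<exists>!p. p \<in> D \<and> stationary_stackelberg T p"
    using unique_fixed by (simp add: stationary cong: conj_cong)
  have limit: "(\<lambda>n. (\<G>1 T ^^ n) q) \<longlonglongrightarrow> p" if "p \<in> D" "\<G>1 T p = p" "q \<in> D" for p q
    using D_invariant \<alpha>_nonneg \<alpha>(2) contr dist_le_M1 that
    by (rule contraction_iterates_tendsto_fixpoint)
  have symmetric: "\<xi> = \<eta> \<and> \<eta> = \<theta>"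
    if "(\<xi>, \<eta>, \<theta>) \<in> D" "\<G>1 T (\<xi>, \<eta>, \<theta>) = (\<xi>, \<eta>, \<theta>)" "(\<eta>, \<theta>, \<xi>) \<in> D"
      "local_triple_cross_symmetry (\<G>1 T) (\<xi>, \<eta>, \<theta>)" for \<xi> \<eta> \<theta>
  proof -
    have "\<G>1 T (\<eta>, \<theta>, \<xi>) = (\<eta>, \<theta>, \<xi>)"
      using that(4,2) by (rule cross_symmetry_shift_fixed)
    then have "(\<eta>, \<theta>, \<xi>) = (\<xi>, \<eta>, \<theta>)"
      using unique_fixed that by blast
    then show ?thesis
      by (metis Pair_inject)
  qed
  show ?thesis
  proof (intro conjI allI ballI impI)
    show "\<exists>!p. p \<in> D \<and> stationary_stackelberg T p" by (rule unique_stationary)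
    show "\<exists>!p. p \<in> D \<and> \<G>1 T p = p" by (rule unique_fixed)
  qed (use stationary limit symmetric in blast)+
qed

end
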